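(* For $0\le t<1$ let $W_t$ be the weighted composition operator on the Hardy space $H^2$ defined by $$W_tf(z)=\frac{f(tz)}{1-tz}\qquad(f\in H^2,\ z\in\mathbb{D}).$$ The only nonzero closed subspaces of $H^2$ invariant under every $W_t$, $0\le t<1$, are the subspaces $z^kH^2$ for some integer $k\ge 0$.
   Context: $\mathbb{D}$ is the open unit disc and $H^2$ is the Hardy space of holomorphic functions $f(z)=\sum_{k\ge 0}x_kz^k$ on $\mathbb{D}$ with $(x_k)_{k\ge 0}\in\ell^2$. A subspace $M$ is invariant under $T$ if $TM\subseteq M$. *)

theory Defs
  imports "HOL-Complex_Analysis.Complex_Analysis" "HOL-Library.Function_Algebras"
begin

text \<open>
  A function on the unit disc is represented by a function on the whole plane that is 0 outside
  the disc, so that equality of functions on the disc is equality in the logic.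
\<close>

definition hardy_space :: "(complex \<Rightarrow> complex) set" where
  "hardy_space = {f. f holomorphic_on ball 0 1 \<and>
     (\<exists>x :: nat \<Rightarrow> complex. summable (\<lambda>k. (cmod (x k))\<^sup>2) \<and>
        (\<forall>z \<in> ball 0 1. (\<lambda>k. x k * z ^ k) sums f z)) \<and>
     (\<forall>z. z \<notin> ball 0 1 \<longrightarrow> f z = 0)}"

definition taylor_coeff :: "(complex \<Rightarrow> complex) \<Rightarrow> nat \<Rightarrow> complex" where
  "taylor_coeff f k = (deriv ^^ k) f 0 / fact k"

definition hardy_norm :: "(complex \<Rightarrow> complex) \<Rightarrow> real" where
  "hardy_norm f = sqrt (\<Sum>k. (cmod (taylor_coeff f k))\<^sup>2)"

text \<open>
  Totalized by 0 outside the space because the locale \<^locale>\<open>Metric_space\<close> asks for symmetry and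
  nonnegativity on the whole type.
\<close>

definition hardy_dist :: "(complex \<Rightarrow> complex) \<Rightarrow> (complex \<Rightarrow> complex) \<Rightarrow> real" where
  "hardy_dist f g =
     (if f \<in> hardy_space \<and> g \<in> hardy_space then hardy_norm (f - g) else 0)"

definition hardy_topology :: "(complex \<Rightarrow> complex) topology" where
  "hardy_topology = Metric_space.mtopology hardy_space hardy_dist"

definition fun_scale :: "complex \<Rightarrow> (complex \<Rightarrow> complex) \<Rightarrow> complex \<Rightarrow> complex" where
  "fun_scale c f = (\<lambda>z. c * f z)"

interpretation cfun: vector_space fun_scale
  by standard (auto simp: fun_scale_def fun_eq_iff algebra_simps)

definition weighted_comp :: "real \<Rightarrow> (complex \<Rightarrow> complex) \<Rightarrow> complex \<Rightarrow> complex" where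
  "weighted_comp t f =
     (\<lambda>z. if z \<in> ball 0 1 then f (of_real t * z) / (1 - of_real t * z) else 0)"

text \<open>The norm is the \<open>\<ell>\<^sup>2\<close> norm of whichever coefficients represent the function:\<close>

lemma taylor_coeff_eqI:
  assumes "\<And>z. z \<in> ball 0 1 \<Longrightarrow> (\<lambda>k. x k * z ^ k) sums f z"
  shows "taylor_coeff f = x"
proof -
  let ?F = "Abs_fps x"
  have "f has_fps_expansion ?F"
  proof (rule has_fps_expansionI)
    have "\<forall>\<^sub>F z in nhds (0::complex). z \<in> ball 0 1"
      by (intro eventually_nhds_in_open) auto
    then show "\<forall>\<^sub>F u in nhds 0. (\<lambda>n. fps_nth ?F n * u ^ n) sums f u"
      by eventually_elim (use assms in simp)
  qed
  from fps_nth_fps_expansion[OF this] show ?thesis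
    by (auto simp: taylor_coeff_def fun_eq_iff)
qed

lemma hardy_spaceD:
  assumes "f \<in> hardy_space"
  shows "f holomorphic_on ball 0 1"
    and "summable (\<lambda>k. (cmod (taylor_coeff f k))\<^sup>2)"
    and "z \<in> ball 0 1 \<Longrightarrow> (\<lambda>k. taylor_coeff f k * z ^ k) sums f z"
    and "z \<notin> ball 0 1 \<Longrightarrow> f z = 0"
proof -
  obtain x where x: "summable (\<lambda>k. (cmod (x k))\<^sup>2)"
      "\<And>z. z \<in> ball 0 1 \<Longrightarrow> (\<lambda>k. x k * z ^ k) sums f z"
    using assms unfolding hardy_space_def by blast
  have "taylor_coeff f = x"
    by (rule taylor_coeff_eqI) (rule x(2))
  with x show "summable (\<lambda>k. (cmod (taylor_coeff f k))\<^sup>2)"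
    and "z \<in> ball 0 1 \<Longrightarrow> (\<lambda>k. taylor_coeff f k * z ^ k) sums f z"
    by auto
qed (use assms in \<open>auto simp: hardy_space_def\<close>)

lemma taylor_coeff_diff:
  assumes "f \<in> hardy_space" "g \<in> hardy_space"
  shows "taylor_coeff (f - g) k = taylor_coeff f k - taylor_coeff g k"
proof -
  have "taylor_coeff (f - g) = (\<lambda>k. taylor_coeff f k - taylor_coeff g k)"
    by (rule taylor_coeff_eqI)
       (use sums_diff[OF hardy_spaceD(3)[OF assms(1)] hardy_spaceD(3)[OF assms(2)]]
        in \<open>simp add: algebra_simps\<close>)
  then show ?thesis by simp
qed

lemma l2_triangle:
  fixes x y :: "nat \<Rightarrow> complex"
  assumes x: "summable (\<lambda>k. (cmod (x k))\<^sup>2)" and y: "summable (\<lambda>k. (cmod (y k))\<^sup>2)"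
  shows "summable (\<lambda>k. (cmod (x k + y k))\<^sup>2)"
    and "sqrt (\<Sum>k. (cmod (x k + y k))\<^sup>2) \<le>
      sqrt (\<Sum>k. (cmod (x k))\<^sup>2) + sqrt (\<Sum>k. (cmod (y k))\<^sup>2)" (is "_ \<le> ?B")
proof -
  have B: "0 \<le> ?B"
    by (intro add_nonneg_nonneg real_sqrt_ge_zero suminf_nonneg x y) auto
  have le: "(\<Sum>k<n. (cmod (x k + y k))\<^sup>2) \<le> ?B\<^sup>2" for n
  proof -
    have "sqrt (\<Sum>k<n. (cmod (x k + y k))\<^sup>2) \<le> L2_set (\<lambda>k. cmod (x k) + cmod (y k)) {..<n}"
      unfolding L2_set_def
      by (intro real_sqrt_le_mono sum_mono power_mono norm_triangle_ineq) auto
    also have "\<dots> \<le> L2_set (\<lambda>k. cmod (x k)) {..<n} + L2_set (\<lambda>k. cmod (y k)) {..<n}"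
      by (rule L2_set_triangle_ineq)
    also have "\<dots> \<le> ?B"
      unfolding L2_set_def
      by (intro add_mono real_sqrt_le_mono sum_le_suminf x y) auto
    finally show ?thesis
      by (simp add: B sqrt_le_D)
  qed
  show s: "summable (\<lambda>k. (cmod (x k + y k))\<^sup>2)"
    by (rule bounded_imp_summable[where B = "?B\<^sup>2"])
       (use le[of "Suc _"] in \<open>auto simp: lessThan_Suc_atMost\<close>)
  have "(\<Sum>k. (cmod (x k + y k))\<^sup>2) \<le> ?B\<^sup>2"
    by (rule suminf_le_const[OF s le])
  then show "sqrt (\<Sum>k. (cmod (x k + y k))\<^sup>2) \<le> ?B"
    using B by (rule real_le_lsqrt[rotated 1])
qed

lemma hardy_dist_eq:
  assumes "f \<in> hardy_space" "g \<in> hardy_space"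
  shows "hardy_dist f g = sqrt (\<Sum>k. (cmod (taylor_coeff f k - taylor_coeff g k))\<^sup>2)"
    and "summable (\<lambda>k. (cmod (taylor_coeff f k - taylor_coeff g k))\<^sup>2)"
proof -
  show "hardy_dist f g = sqrt (\<Sum>k. (cmod (taylor_coeff f k - taylor_coeff g k))\<^sup>2)"
    using assms by (simp add: hardy_dist_def hardy_norm_def taylor_coeff_diff)
  show "summable (\<lambda>k. (cmod (taylor_coeff f k - taylor_coeff g k))\<^sup>2)"
    using l2_triangle(1)[of "taylor_coeff f" "\<lambda>k. - taylor_coeff g k"]
      hardy_spaceD(2)[OF assms(1)] hardy_spaceD(2)[OF assms(2)] by simp
qed

interpretation hardy: Metric_space hardy_space hardy_dist
  rewrites "hardy.mtopology = hardy_topology"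
proof -
  show "Metric_space hardy_space hardy_dist"
  proof
    fix f g
    show "0 \<le> hardy_dist f g"
    proof (cases "f \<in> hardy_space \<and> g \<in> hardy_space")
      case True
      then show ?thesis
        by (auto simp: hardy_dist_eq intro!: suminf_nonneg)
    qed (auto simp: hardy_dist_def)
    show "hardy_dist f g = hardy_dist g f"
    proof (cases "f \<in> hardy_space \<and> g \<in> hardy_space")
      case True
      then show ?thesis
        by (auto simp: hardy_dist_eq norm_minus_commute)
    qed (auto simp: hardy_dist_def)
  next
    fix f g assume f: "f \<in> hardy_space" and g: "g \<in> hardy_space"
    show "hardy_dist f g = 0 \<longleftrightarrow> f = g"
    proof
      assume "hardy_dist f g = 0"
      then have "(\<Sum>k. (cmod (taylor_coeff f k - taylor_coeff g k))\<^sup>2) = 0"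
        using f g by (simp add: hardy_dist_eq)
      then have eq: "taylor_coeff f = taylor_coeff g"
        using suminf_eq_zero_iff[OF hardy_dist_eq(2)[OF f g]] by (auto simp: fun_eq_iff)
      show "f = g"
      proof
        fix z show "f z = g z"
          using hardy_spaceD(3,4)[OF f, of z] hardy_spaceD(3,4)[OF g, of z] eq
          by (cases "z \<in> ball 0 1") (auto intro: sums_unique2)
      qed
    qed (use f in \<open>simp add: hardy_dist_eq\<close>)
  next
    fix f g h assume f: "f \<in> hardy_space" and g: "g \<in> hardy_space" and h: "h \<in> hardy_space"
    show "hardy_dist f h \<le> hardy_dist f g + hardy_dist g h"
      using l2_triangle(2)[OF hardy_dist_eq(2)[OF f g] hardy_dist_eq(2)[OF g h]]
      by (simp add: hardy_dist_eq f g h)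
  qed
qed (simp add: hardy_topology_def)

end

theory Submission
  imports Defs
begin

text \<open>
  On Taylor coefficients, \<open>W\<^sub>t\<close> sends \<open>(a\<^sub>m)\<close> to \<open>(t\<^sup>m s\<^sub>m)\<close>, where \<open>s\<^sub>m = a\<^sub>0 + \<dots> + a\<^sub>m\<close>.
  If a closed subspace contains \<open>\<Sum>\<^sub>m t\<^sup>m c\<^sub>m z\<^sup>m\<close> for all \<open>t \<in> (0,1)\<close>, then it contains every
  \<open>c\<^sub>n z\<^sup>n\<close>: subtract the terms of degree below \<open>n\<close>, divide by \<open>t\<^sup>n\<close> and let \<open>t\<close> tend to 0.
  Applied to \<open>W\<^sub>t f\<close>, where \<open>f \<in> M\<close> has the least order \<open>k\<close> of vanishing at 0, this puts \<open>z\<^sup>k\<close>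
  into \<open>M\<close>. Applied to \<open>W\<^sub>t z\<^sup>k = t\<^sup>k z\<^sup>k / (1 - t z)\<close>, all of whose coefficients from degree \<open>k\<close> on
  are powers of \<open>t\<close>, it puts all \<open>z\<^sup>n\<close> with \<open>n \<ge> k\<close> into \<open>M\<close>, and these span a dense subspace
  of \<open>z\<^sup>k H\<^sup>2\<close>.
\<close>

section \<open>Taylor coefficients on the Hardy space\<close>

text \<open>The terms are eventually below 1 and then dominate their squares. This puts functions
  with absolutely summable coefficients into \<open>hardy_space\<close>.\<close>

lemma summable_norm_power2:
  fixes a :: "nat \<Rightarrow> 'a::real_normed_vector"
  assumes "summable (\<lambda>k. norm (a k))"
  shows "summable (\<lambda>k. (norm (a k))\<^sup>2)"
proof -
  have "(\<lambda>k. norm (a k)) \<longlonglongrightarrow> 0"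
    using assms by (rule summable_LIMSEQ_zero)
  then have "\<forall>\<^sub>F k in sequentially. norm (a k) < 1"
    by (rule order_tendstoD) simp
  then have "\<forall>\<^sub>F k in sequentially. norm ((norm (a k))\<^sup>2) \<le> norm (a k)"
    by eventually_elim (simp add: power2_eq_square mult_left_le)
  then show ?thesis
    using assms by (rule summable_comparison_test_ev)
qed

lemma hardy_spaceI:
  assumes "summable (\<lambda>k. (cmod (x k))\<^sup>2)"
    and sums: "\<And>z. z \<in> ball 0 1 \<Longrightarrow> (\<lambda>k. x k * z ^ k) sums f z"
    and "\<And>z. z \<notin> ball 0 1 \<Longrightarrow> f z = 0"
  shows "f \<in> hardy_space"
proof -
  have "f holomorphic_on ball 0 1"
    by (rule power_series_holomorphic[where a = x]) (use sums in simp)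
  then show ?thesis
    using assms unfolding hardy_space_def by blast
qed

lemma hardy_space_eqI:
  assumes f: "f \<in> hardy_space" and g: "g \<in> hardy_space"
    and eq: "taylor_coeff f = taylor_coeff g"
  shows "f = g"
proof
  fix z show "f z = g z"
    using hardy_spaceD(3,4)[OF f, of z] hardy_spaceD(3,4)[OF g, of z] eq
    by (cases "z \<in> ball 0 1") (auto intro: sums_unique2)
qed

text \<open>A square summable sequence tends to 0, hence is bounded, so its power series is
  dominated by a geometric series at every point of the disc.\<close>

lemma hardy_space_of_l2:
  assumes l2: "summable (\<lambda>k. (cmod (x k))\<^sup>2)"
  obtains f where "f \<in> hardy_space" "taylor_coeff f = x"
proof -
  have "(\<lambda>k. (cmod (x k))\<^sup>2) \<longlonglongrightarrow> 0"
    using l2 by (rule summable_LIMSEQ_zero)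
  then have "(\<lambda>k. sqrt ((cmod (x k))\<^sup>2)) \<longlonglongrightarrow> sqrt 0"
    by (rule tendsto_real_sqrt)
  then have "x \<longlonglongrightarrow> 0"
    by (simp add: tendsto_norm_zero_iff)
  then have "Bseq x"
    using convergentI convergent_imp_Bseq by blast
  then obtain C where C: "\<And>k. cmod (x k) \<le> C"
    by (auto simp: Bseq_def)
  define f where "f = (\<lambda>z. if z \<in> ball 0 1 then \<Sum>k. x k * z ^ k else 0)"
  have sums: "(\<lambda>k. x k * z ^ k) sums f z" if z: "z \<in> ball 0 1" for z
  proof -
    have "summable (\<lambda>k. C * cmod z ^ k)"
      using z by (intro summable_mult summable_geometric) simp
    then have "summable (\<lambda>k. x k * z ^ k)"
      by (rule summable_comparison_test'[where N = 0])
         (simp add: norm_mult norm_power mult_right_mono C)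
    then show ?thesis
      using z by (simp add: f_def summable_sums)
  qed
  have "f \<in> hardy_space"
    by (rule hardy_spaceI[OF l2 sums]) (simp_all add: f_def)
  then show thesis
    using that taylor_coeff_eqI[OF sums] by blast
qed

lemma zero_in_hardy_space: "0 \<in> hardy_space"
  and taylor_coeff_zero: "taylor_coeff 0 k = 0"
proof -
  have *: "(\<lambda>k. (\<lambda>_. 0) k * z ^ k) sums (0 :: complex \<Rightarrow> complex) z" for z
    by simp
  show "0 \<in> hardy_space"
    by (rule hardy_spaceI[OF _ *]) auto
  have "taylor_coeff 0 = (\<lambda>_. 0)"
    by (rule taylor_coeff_eqI[OF *])
  then show "taylor_coeff 0 k = 0" by simp
qed

lemma
  assumes f: "f \<in> hardy_space" and g: "g \<in> hardy_space"
  shows add_in_hardy_space: "f + g \<in> hardy_space"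
    and taylor_coeff_add: "taylor_coeff (f + g) k = taylor_coeff f k + taylor_coeff g k"
proof -
  have *: "(\<lambda>k. (taylor_coeff f k + taylor_coeff g k) * z ^ k) sums (f + g) z"
    if "z \<in> ball 0 1" for z
    using sums_add[OF hardy_spaceD(3)[OF f that] hardy_spaceD(3)[OF g that]]
    by (simp add: algebra_simps)
  show "f + g \<in> hardy_space"
    by (rule hardy_spaceI[OF l2_triangle(1)[OF hardy_spaceD(2)[OF f] hardy_spaceD(2)[OF g]] *])
       (use hardy_spaceD(4)[OF f] hardy_spaceD(4)[OF g] in auto)
  have "taylor_coeff (f + g) = (\<lambda>k. taylor_coeff f k + taylor_coeff g k)"
    by (rule taylor_coeff_eqI[OF *])
  then show "taylor_coeff (f + g) k = taylor_coeff f k + taylor_coeff g k" by simp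
qed

lemma
  assumes f: "f \<in> hardy_space"
  shows fun_scale_in_hardy_space: "fun_scale c f \<in> hardy_space"
    and taylor_coeff_fun_scale: "taylor_coeff (fun_scale c f) k = c * taylor_coeff f k"
proof -
  have *: "(\<lambda>k. (c * taylor_coeff f k) * z ^ k) sums fun_scale c f z"
    if "z \<in> ball 0 1" for z
    using sums_mult[OF hardy_spaceD(3)[OF f that], of c]
    by (simp add: fun_scale_def mult.assoc)
  have "summable (\<lambda>k. (cmod (c * taylor_coeff f k))\<^sup>2)"
    using summable_mult[OF hardy_spaceD(2)[OF f], of "(cmod c)\<^sup>2"]
    by (simp add: norm_mult power_mult_distrib)
  then show "fun_scale c f \<in> hardy_space"
    by (rule hardy_spaceI[OF _ *]) (use hardy_spaceD(4)[OF f] in \<open>auto simp: fun_scale_def\<close>)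
  show "taylor_coeff (fun_scale c f) k = c * taylor_coeff f k"
    using taylor_coeff_eqI[OF *] by simp
qed

lemma taylor_coeff_sum:
  assumes "finite A" "\<And>j. j \<in> A \<Longrightarrow> g j \<in> hardy_space"
  shows "taylor_coeff (\<Sum>j\<in>A. g j) k = (\<Sum>j\<in>A. taylor_coeff (g j) k)"
proof -
  have "(\<Sum>j\<in>A. g j) \<in> hardy_space \<and>
      taylor_coeff (\<Sum>j\<in>A. g j) k = (\<Sum>j\<in>A. taylor_coeff (g j) k)"
    using assms
    by (induction A rule: finite_induct)
       (auto simp: zero_in_hardy_space taylor_coeff_zero add_in_hardy_space taylor_coeff_add)
  then show ?thesis ..
qed

text \<open>The bare power \<open>z ^ n\<close> is not in \<open>hardy_space\<close>, whose members
  vanish off the disc.\<close>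

definition disc_monomial :: "nat \<Rightarrow> complex \<Rightarrow> complex" where
  "disc_monomial n z = (if z \<in> ball 0 1 then z ^ n else 0)"

lemma disc_monomial_in_hardy_space: "disc_monomial n \<in> hardy_space"
  and taylor_coeff_disc_monomial:
    "taylor_coeff (disc_monomial n) k = (if k = n then 1 else 0)"
proof -
  have *: "(\<lambda>k. (if k = n then 1 else 0) * z ^ k) sums disc_monomial n z"
    if "z \<in> ball 0 1" for z
    using sums_If_finite_set[of "{n}" "\<lambda>k. z ^ k"] that
    by (simp add: disc_monomial_def if_distrib[of "\<lambda>c. c * _"] cong: if_cong)
  have "summable (\<lambda>k. (cmod (if k = n then 1 else 0))\<^sup>2)"
    by (rule summable_finite[of "{n}"]) auto
  then show "disc_monomial n \<in> hardy_space"
    by (rule hardy_spaceI[OF _ *]) (auto simp: disc_monomial_def)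
  show "taylor_coeff (disc_monomial n) k = (if k = n then 1 else 0)"
    using taylor_coeff_eqI[OF *] by simp
qed

text \<open>One term of a series of squares is at most the whole. Thus each coefficient functional
  is continuous, which makes subspaces given by vanishing coefficients closed.\<close>

lemma norm_taylor_coeff_diff_le_hardy_dist:
  assumes f: "f \<in> hardy_space" and g: "g \<in> hardy_space"
  shows "cmod (taylor_coeff f k - taylor_coeff g k) \<le> hardy_dist f g"
proof -
  have "(cmod (taylor_coeff f k - taylor_coeff g k))\<^sup>2
      \<le> (\<Sum>k. (cmod (taylor_coeff f k - taylor_coeff g k))\<^sup>2)"
    using sum_le_suminf[OF hardy_dist_eq(2)[OF f g], of "{k}"] by simp
  then show ?thesis
    using f g by (simp add: hardy_dist_eq real_le_rsqrt)
qed

text \<open>Multiplication by \<open>z ^ k\<close> shifts the coefficients by \<open>k\<close>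
  places, and padding with zeros or dropping them does not affect square summability.\<close>

lemma image_power_mult_hardy_space:
  "(\<lambda>f z. z ^ k * f z) ` hardy_space = {f \<in> hardy_space. \<forall>j<k. taylor_coeff f j = 0}"
  (is "?L = ?R")
proof
  show "?L \<subseteq> ?R"
  proof
    fix g assume "g \<in> ?L"
    then obtain f where f: "f \<in> hardy_space" and g: "g = (\<lambda>z. z ^ k * f z)"
      by blast
    let ?x = "\<lambda>m. if m < k then 0 else taylor_coeff f (m - k)"
    have sums: "(\<lambda>m. ?x m * z ^ m) sums g z" if "z \<in> ball 0 1" for z
    proof -
      have "(\<lambda>m. ?x (m + k) * z ^ (m + k)) sums g z"
        using sums_mult[OF hardy_spaceD(3)[OF f that], of "z ^ k"]
        by (simp add: g power_add mult_ac)
      then show ?thesis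
        by (subst (asm) sums_zero_iff_shift) auto
    qed
    have "summable (\<lambda>m. (cmod (?x (m + k)))\<^sup>2)"
      using hardy_spaceD(2)[OF f] by simp
    then have "summable (\<lambda>m. (cmod (?x m))\<^sup>2)"
      by (subst (asm) summable_iff_shift)
    then have "g \<in> hardy_space"
      by (rule hardy_spaceI[OF _ sums]) (use hardy_spaceD(4)[OF f] in \<open>auto simp: g\<close>)
    then show "g \<in> ?R"
      using taylor_coeff_eqI[OF sums] by simp
  qed
  show "?R \<subseteq> ?L"
  proof
    fix g assume "g \<in> ?R"
    then have g: "g \<in> hardy_space" and 0: "\<And>j. j < k \<Longrightarrow> taylor_coeff g j = 0"
      by auto
    have "summable (\<lambda>m. (cmod (taylor_coeff g (m + k)))\<^sup>2)"
      using hardy_spaceD(2)[OF g] summable_iff_shift[of "\<lambda>m. (cmod (taylor_coeff g m))\<^sup>2" k]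
      by simp
    then obtain f where f: "f \<in> hardy_space" "taylor_coeff f = (\<lambda>m. taylor_coeff g (m + k))"
      by (rule hardy_space_of_l2)
    have "g z = z ^ k * f z" for z
    proof (cases "z \<in> ball 0 1")
      case True
      have "(\<lambda>m. taylor_coeff g (m + k) * z ^ (m + k)) sums (z ^ k * f z)"
        using sums_mult[OF hardy_spaceD(3)[OF f(1) True], of "z ^ k"]
        by (simp add: f(2) power_add mult_ac)
      then have "(\<lambda>m. taylor_coeff g m * z ^ m) sums (z ^ k * f z)"
        by (subst (asm) sums_zero_iff_shift) (auto simp: 0)
      then show ?thesis
        using hardy_spaceD(3)[OF g True] sums_unique2 by blast
    qed (use hardy_spaceD(4)[OF g] hardy_spaceD(4)[OF f(1)] in auto)
    then show "g \<in> ?L"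
      using f(1) by auto
  qed
qed

text \<open>The function \<open>f w / (1 - w)\<close> is the Cauchy product of \<open>f\<close> with
  the geometric series, so its coefficients are the partial sums of those of \<open>f\<close>.
  Substituting \<open>t * z\<close> for \<open>w\<close> contributes the factor
  \<open>t ^ m\<close>.\<close>

lemma
  assumes f: "f \<in> hardy_space" and t: "0 \<le> t" "t < 1"
  shows weighted_comp_in_hardy_space: "weighted_comp t f \<in> hardy_space"
    and taylor_coeff_weighted_comp:
      "taylor_coeff (weighted_comp t f) m = of_real t ^ m * (\<Sum>j\<le>m. taylor_coeff f j)"
proof -
  define s where "s = (\<lambda>m. \<Sum>j\<le>m. taylor_coeff f j)"
  have s_sums: "(\<lambda>m. s m * w ^ m) sums (f w / (1 - w))" if w: "w \<in> ball 0 1" for w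
  proof -
    \<comment> \<open>Convergence at a point of larger modulus gives the absolute convergence at
      \<open>w\<close> that the Cauchy product needs.\<close>
    obtain r where r: "cmod w < r" "r < 1"
      using w dense by auto
    then have "0 \<le> r"
      using norm_ge_zero[of w] by linarith
    have "summable (\<lambda>k. taylor_coeff f k * of_real r ^ k)"
      by (rule sums_summable, rule hardy_spaceD(3)[OF f]) (use r \<open>0 \<le> r\<close> in simp)
    then have 1: "summable (\<lambda>k. norm (taylor_coeff f k * w ^ k))"
      by (rule powser_insidea) (use r \<open>0 \<le> r\<close> in simp)
    have 2: "summable (\<lambda>k. norm (w ^ k))"
      using w by (simp add: norm_power summable_geometric)
    have "(\<lambda>m. \<Sum>j\<le>m. (taylor_coeff f j * w ^ j) * w ^ (m - j))
        sums ((\<Sum>k. taylor_coeff f k * w ^ k) * (\<Sum>k. w ^ k))"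
      by (rule Cauchy_product_sums[OF 1 2])
    moreover have "(\<Sum>j\<le>m. (taylor_coeff f j * w ^ j) * w ^ (m - j)) = s m * w ^ m" for m
      unfolding s_def sum_distrib_right
      by (rule sum.cong) (auto simp: mult.assoc simp flip: power_add)
    moreover have "(\<Sum>k. taylor_coeff f k * w ^ k) = f w"
      using hardy_spaceD(3)[OF f w] by (rule sums_unique[symmetric])
    moreover have "(\<Sum>k. w ^ k) = 1 / (1 - w)"
      using w by (intro suminf_geometric) simp
    ultimately show ?thesis by simp
  qed
  let ?x = "\<lambda>m. of_real t ^ m * s m"
  have sums: "(\<lambda>m. ?x m * z ^ m) sums weighted_comp t f z" if z: "z \<in> ball 0 1" for z
  proof -
    have "t * cmod z < 1"
      using t z mult_left_le[of "cmod z" t] by simp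
    then have "of_real t * z \<in> ball 0 1"
      using t by (simp add: norm_mult)
    from s_sums[OF this] z show ?thesis
      by (simp add: weighted_comp_def power_mult_distrib mult_ac)
  qed
  \<comment> \<open>The partial sums \<open>s m\<close> need not be square summable. Convergence of
    their power series at some \<open>r > t\<close> makes \<open>s m * t ^ m\<close> absolutely
    summable, hence square summable.\<close>
  obtain r where r: "t < r" "r < 1"
    using t dense by blast
  have "summable (\<lambda>m. s m * of_real r ^ m)"
    by (rule sums_summable, rule s_sums) (use r t in auto)
  then have "summable (\<lambda>m. cmod (s m * of_real t ^ m))"
    by (rule powser_insidea) (use r t in auto)
  then have "summable (\<lambda>m. cmod (?x m))"
    by (simp add: mult.commute)
  then have "summable (\<lambda>m. (cmod (?x m))\<^sup>2)"
    by (rule summable_norm_power2)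
  then show "weighted_comp t f \<in> hardy_space"
    by (rule hardy_spaceI[OF _ sums]) (auto simp: weighted_comp_def)
  show "taylor_coeff (weighted_comp t f) m = of_real t ^ m * (\<Sum>j\<le>m. taylor_coeff f j)"
    using taylor_coeff_eqI[OF sums] by (simp add: s_def)
qed

section \<open>Closed subspaces\<close>

text \<open>The contrapositive of openness of the complement; below, membership in a closed
  \<open>M\<close> is always shown by approximation from \<open>M\<close>.\<close>

lemma closedin_hardy_topology_iff:
  assumes "M \<subseteq> hardy_space"
  shows "closedin hardy_topology M \<longleftrightarrow>
    (\<forall>f\<in>hardy_space. (\<forall>e>0. \<exists>g\<in>M. hardy_dist f g < e) \<longrightarrow> f \<in> M)"
proof -
  have "disjnt M (hardy.mball f e) \<longleftrightarrow> (\<forall>g\<in>M. \<not> hardy_dist f g < e)"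
    if "f \<in> hardy_space" for f e
    using that assms unfolding disjnt_iff hardy.in_mball by blast
  then have "closedin hardy_topology M \<longleftrightarrow>
      (\<forall>f\<in>hardy_space - M. \<exists>e>0. \<forall>g\<in>M. \<not> hardy_dist f g < e)"
    using assms unfolding hardy.closedin_metric by (metis (no_types, lifting) DiffD1)
  then show ?thesis by blast
qed

lemma closedin_vanishing_taylor_coeffs:
  "closedin hardy_topology {f \<in> hardy_space. \<forall>j\<in>J. taylor_coeff f j = 0}" (is "closedin _ ?M")
proof -
  have "taylor_coeff f j = 0"
    if f: "f \<in> hardy_space" and approx: "\<forall>e>0. \<exists>g\<in>?M. hardy_dist f g < e" and "j \<in> J" for f j
  proof (rule ccontr)
    assume "taylor_coeff f j \<noteq> 0"
    then obtain g where "g \<in> ?M" "hardy_dist f g < cmod (taylor_coeff f j)"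
      using approx by (meson zero_less_norm_iff)
    then show False
      using norm_taylor_coeff_diff_le_hardy_dist[OF f, of g j] \<open>j \<in> J\<close> by auto
  qed
  then show ?thesis
    by (subst closedin_hardy_topology_iff) blast+
qed

lemma subspace_vanishing_taylor_coeffs:
  "cfun.subspace {f \<in> hardy_space. \<forall>j\<in>J. taylor_coeff f j = 0}"
  by (rule cfun.subspaceI)
     (auto simp: zero_in_hardy_space taylor_coeff_zero add_in_hardy_space taylor_coeff_add
        fun_scale_in_hardy_space taylor_coeff_fun_scale)

lemma taylor_coeff_truncation:
  "taylor_coeff (\<Sum>j<n. fun_scale (c j) (disc_monomial j)) m = (if m < n then c m else 0)"
proof -
  have "taylor_coeff (\<Sum>j<n. fun_scale (c j) (disc_monomial j)) m
      = (\<Sum>j<n. if m = j then c j else 0)"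
    by (subst taylor_coeff_sum)
       (auto simp: fun_scale_in_hardy_space disc_monomial_in_hardy_space
          taylor_coeff_fun_scale taylor_coeff_disc_monomial if_distrib[of "(*) _"] cong: if_cong)
  then show ?thesis by simp
qed

lemma closed_subspace_contains_if_monomials:
  assumes M: "M \<subseteq> hardy_space" "cfun.subspace M" "closedin hardy_topology M"
    and f: "f \<in> hardy_space"
    and mono: "\<And>n. fun_scale (taylor_coeff f n) (disc_monomial n) \<in> M"
  shows "f \<in> M"
proof -
  have "\<exists>g\<in>M. hardy_dist f g < e" if e: "e > 0" for e
  proof -
    \<comment> \<open>The squared distance from \<open>f\<close> to its Taylor polynomial of degree
      below \<open>N\<close> is exactly this tail.\<close>
    obtain N where N: "norm (\<Sum>i. (cmod (taylor_coeff f (i + N)))\<^sup>2) < e\<^sup>2"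
      using suminf_exist_split[OF _ hardy_spaceD(2)[OF f], of "e\<^sup>2"] e by auto
    define p where "p = (\<Sum>j<N. fun_scale (taylor_coeff f j) (disc_monomial j))"
    have "p \<in> M"
      unfolding p_def by (intro cfun.subspace_sum M mono)
    then have p: "p \<in> hardy_space"
      using M by blast
    have diff: "taylor_coeff f m - taylor_coeff p m = (if m < N then 0 else taylor_coeff f m)" for m
      by (simp add: p_def taylor_coeff_truncation)
    have "(\<Sum>m. (cmod (taylor_coeff f m - taylor_coeff p m))\<^sup>2)
        = (\<Sum>i. (cmod (taylor_coeff f (i + N)))\<^sup>2)"
      using suminf_split_initial_segment[OF hardy_dist_eq(2)[OF f p], of N]
      by (simp add: diff)
    also have "\<dots> < e\<^sup>2"
      using N by simp
    finally have "hardy_dist f p < e"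
      using e by (simp add: hardy_dist_eq[OF f p] real_less_lsqrt)
    then show ?thesis
      using \<open>p \<in> M\<close> by blast
  qed
  then show ?thesis
    using M f closedin_hardy_topology_iff by blast
qed

text \<open>No growth bound on \<open>c\<close> is assumed: membership of \<open>g (1/2)\<close> in
  \<open>hardy_space\<close> makes \<open>c m / 2 ^ m\<close> square summable, and this controls the
  remainder for all \<open>t\<close> up to 1/2.\<close>

lemma closed_subspace_contains_monomials_of_dilations:
  assumes M: "M \<subseteq> hardy_space" "cfun.subspace M" "closedin hardy_topology M"
    and dil: "\<And>t::real. 0 < t \<Longrightarrow> t < 1 \<Longrightarrow> g t \<in> M"
    and g: "\<And>t m. 0 < t \<Longrightarrow> t < 1 \<Longrightarrow> taylor_coeff (g t) m = of_real t ^ m * c m"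
  shows "fun_scale (c n) (disc_monomial n) \<in> M"
proof (induction n rule: less_induct)
  case (less n)
  let ?f = "fun_scale (c n) (disc_monomial n)"
  have f: "?f \<in> hardy_space"
    by (simp add: fun_scale_in_hardy_space disc_monomial_in_hardy_space)
  define b where "b = (\<lambda>m. (cmod (taylor_coeff (g (1/2)) m))\<^sup>2)"
  have b: "summable b"
    unfolding b_def by (rule hardy_spaceD(2)) (use dil[of "1/2"] M in auto)
  \<comment> \<open>For \<open>m = n + 1 + i\<close> the error in coefficient \<open>m\<close> will
    be \<open>t ^ (i + 1) * cmod (c m)\<close>, at most \<open>t * 2 ^ (n + 1)\<close> times
    \<open>cmod (c m) / 2 ^ m\<close>. Squaring and summing gives at most
    \<open>t\<^sup>2 * K\<close>.\<close>
  define K where "K = 4 ^ (n + 1) * suminf b"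
  have "K \<ge> 0"
    unfolding K_def by (intro mult_nonneg_nonneg suminf_nonneg b) (auto simp: b_def)
  have "\<exists>h\<in>M. hardy_dist ?f h < e" if e: "e > 0" for e
  proof -
    \<comment> \<open>The summand 1 keeps the denominator positive when \<open>K = 0\<close> and
      makes the final estimate strict.\<close>
    define t where "t = min (1/2) (e / (sqrt K + 1))"
    have "sqrt K + 1 > 0"
      using \<open>K \<ge> 0\<close> by (simp add: add_nonneg_pos)
    then have "0 < t" "t \<le> 1/2"
      unfolding t_def using e by (simp, intro min.cobounded1)
    then have t: "0 < t" "t \<le> 1/2" "t < 1"
      by simp_all
    have "t \<le> e / (sqrt K + 1)"
      by (simp add: t_def)
    then have te: "t * (sqrt K + 1) \<le> e"
      using \<open>sqrt K + 1 > 0\<close> by (simp only: pos_le_divide_eq)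
    \<comment> \<open>Removing the terms below degree \<open>n\<close> and rescaling makes the
      coefficient of \<open>h\<close> at \<open>n\<close> equal to \<open>c n\<close>. The removed
      terms lie in \<open>M\<close> by the induction hypothesis.\<close>
    define h where "h = fun_scale (1 / of_real t ^ n)
      (g t - (\<Sum>j<n. fun_scale (of_real t ^ j * c j) (disc_monomial j)))"
    have p: "(\<Sum>j<n. fun_scale (of_real t ^ j * c j) (disc_monomial j)) \<in> M"
    proof (rule cfun.subspace_sum[OF M(2)])
      fix j assume "j \<in> {..<n}"
      then show "fun_scale (of_real t ^ j * c j) (disc_monomial j) \<in> M"
        using cfun.subspace_scale[OF M(2) less, of j "of_real t ^ j"] by simp
    qed
    then have "h \<in> M"
      unfolding h_def by (intro cfun.subspace_scale cfun.subspace_diff M dil t)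
    then have h: "h \<in> hardy_space"
      using M by blast
    have "g t - (\<Sum>j<n. fun_scale (of_real t ^ j * c j) (disc_monomial j)) \<in> M"
      using p by (intro cfun.subspace_diff M dil t)
    then have coeff_h: "taylor_coeff h m = (if m < n then 0 else of_real t ^ m * c m / of_real t ^ n)"
      for m
      using M t p dil[of t] unfolding h_def
      by (subst taylor_coeff_fun_scale)
         (auto simp: taylor_coeff_diff subset_iff g taylor_coeff_truncation)
    have bound: "(cmod (taylor_coeff ?f m - taylor_coeff h m))\<^sup>2 \<le> t\<^sup>2 * 4 ^ (n + 1) * b m" for m
    proof (cases "m \<le> n")
      case True
      then have "taylor_coeff ?f m - taylor_coeff h m = 0"
        using t by (auto simp: coeff_h taylor_coeff_fun_scale disc_monomial_in_hardy_space
            taylor_coeff_disc_monomial)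
      then show ?thesis
        by (simp add: b_def)
    next
      case False
      then obtain i where i: "m = n + Suc i"
        using less_imp_Suc_add[of n m] by auto
      have "cmod (taylor_coeff ?f m - taylor_coeff h m) = t * t ^ i * cmod (c m)"
        using t i by (simp add: coeff_h taylor_coeff_fun_scale disc_monomial_in_hardy_space
            taylor_coeff_disc_monomial norm_mult norm_divide norm_power power_add)
      \<comment> \<open>Only the powers after the first are bounded by 1/2; the remaining factor
        \<open>t\<close> makes the error small.\<close>
      also have "\<dots> \<le> t * (1/2) ^ i * cmod (c m)"
        using t by (intro mult_right_mono mult_left_mono power_mono) auto
      also have "\<dots> = t * 2 ^ (n + 1) * cmod (taylor_coeff (g (1/2)) m)"
        by (subst g) (auto simp: i norm_mult norm_power norm_divide power_add field_simps)
      finally have "(cmod (taylor_coeff ?f m - taylor_coeff h m))\<^sup>2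
          \<le> (t * 2 ^ (n + 1) * cmod (taylor_coeff (g (1/2)) m))\<^sup>2"
        by (rule power_mono) simp
      also have "((2::real) ^ (n + 1))\<^sup>2 = 4 ^ (n + 1)"
        by (simp only: power_mult[symmetric] mult.commute[of "n + 1"]) (simp only: power_mult, simp)
      then have "(t * 2 ^ (n + 1) * cmod (taylor_coeff (g (1/2)) m))\<^sup>2 = t\<^sup>2 * 4 ^ (n + 1) * b m"
        by (simp only: power_mult_distrib b_def)
      finally show ?thesis .
    qed
    have "(\<Sum>m. (cmod (taylor_coeff ?f m - taylor_coeff h m))\<^sup>2) \<le> (\<Sum>m. t\<^sup>2 * 4 ^ (n + 1) * b m)"
      by (intro suminf_le bound hardy_dist_eq(2) f h summable_mult b)
    also have "\<dots> = t\<^sup>2 * K"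
      using suminf_mult[OF b, of "t\<^sup>2 * 4 ^ (n + 1)"] by (simp add: K_def mult.assoc)
    finally have "hardy_dist ?f h \<le> sqrt (t\<^sup>2 * K)"
      by (simp only: hardy_dist_eq[OF f h] real_sqrt_le_iff)
    also have "\<dots> < t * (sqrt K + 1)"
      using t by (simp add: real_sqrt_mult algebra_simps)
    also note te
    finally show ?thesis
      using \<open>h \<in> M\<close> by blast
  qed
  then show ?case
    using M f closedin_hardy_topology_iff by blast
qed

section \<open>Invariant subspaces\<close>

lemma invariant_subspace_eq_power_mult:
  assumes M: "M \<subseteq> hardy_space" "cfun.subspace M" "closedin hardy_topology M" and "M \<noteq> {0}"
    and inv: "\<And>t f. 0 \<le> t \<Longrightarrow> t < 1 \<Longrightarrow> f \<in> M \<Longrightarrow> weighted_comp t f \<in> M"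
  shows "\<exists>k. M = (\<lambda>f z. z ^ k * f z) ` hardy_space"
proof -
  let ?P = "\<lambda>k. \<exists>f\<in>M. taylor_coeff f k \<noteq> 0"
  have "0 \<in> M"
    by (rule cfun.subspace_0[OF M(2)])
  then obtain f0 where "f0 \<in> M" "f0 \<noteq> 0"
    using \<open>M \<noteq> {0}\<close> by blast
  \<comment> \<open>Coefficients determine the function, so a nonzero member of \<open>M\<close> has
    a nonzero coefficient.\<close>
  then have "taylor_coeff f0 \<noteq> taylor_coeff 0"
    using hardy_space_eqI[of f0 0] M zero_in_hardy_space by blast
  then have ex: "\<exists>k. ?P k"
    using \<open>f0 \<in> M\<close> by (auto simp: fun_eq_iff taylor_coeff_zero)
  define k where "k = (LEAST k. ?P k)"
  have "?P k"
    unfolding k_def using ex by (rule LeastI_ex)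
  then obtain f where f: "f \<in> M" "taylor_coeff f k \<noteq> 0"
    by blast
  have low: "taylor_coeff h j = 0" if "h \<in> M" "j < k" for h j
    using not_less_Least[of j ?P] that unfolding k_def by blast
  have "fun_scale (\<Sum>j\<le>k. taylor_coeff f j) (disc_monomial k) \<in> M"
    by (rule closed_subspace_contains_monomials_of_dilations
          [OF M, where g = "\<lambda>t. weighted_comp t f"])
       (use f(1) M in \<open>auto simp: inv taylor_coeff_weighted_comp\<close>)
  \<comment> \<open>By minimality of \<open>k\<close> only the last summand survives, so the
    multiple of \<open>disc_monomial k\<close> just found is a nonzero one.\<close>
  moreover have "(\<Sum>j\<le>k. taylor_coeff f j) = taylor_coeff f k"
    using low[OF f(1)] by (simp add: lessThan_Suc_atMost[symmetric])
  ultimately have "fun_scale (taylor_coeff f k) (disc_monomial k) \<in> M"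
    by simp
  then have "fun_scale (1 / taylor_coeff f k)
      (fun_scale (taylor_coeff f k) (disc_monomial k)) \<in> M"
    by (rule cfun.subspace_scale[OF M(2)])
  then have base: "disc_monomial k \<in> M"
    using f(2) by (simp add: fun_scale_def)
  have mono: "disc_monomial n \<in> M" if "n \<ge> k" for n
  proof -
    have "fun_scale (\<Sum>j\<le>n. taylor_coeff (disc_monomial k) j) (disc_monomial n) \<in> M"
      by (rule closed_subspace_contains_monomials_of_dilations
            [OF M, where g = "\<lambda>t. weighted_comp t (disc_monomial k)"])
         (use base M in \<open>auto simp: inv taylor_coeff_weighted_comp\<close>)
    \<comment> \<open>The partial sums for \<open>disc_monomial k\<close> jump from 0 to 1 at
      \<open>k\<close> and stay there, so one monomial yields all higher ones.\<close>
    moreover have "(\<Sum>j\<le>n. taylor_coeff (disc_monomial k) j) = 1"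
      using that by (simp add: taylor_coeff_disc_monomial)
    ultimately show ?thesis
      by (simp add: fun_scale_def)
  qed
  have "h \<in> M" if h: "h \<in> hardy_space" "\<forall>j<k. taylor_coeff h j = 0" for h
  proof (rule closed_subspace_contains_if_monomials[OF M h(1)])
    fix n show "fun_scale (taylor_coeff h n) (disc_monomial n) \<in> M"
    proof (cases "n < k")
      case True
      then have "fun_scale (taylor_coeff h n) (disc_monomial n) = 0"
        using h(2) by (auto simp: fun_scale_def)
      then show ?thesis
        using \<open>0 \<in> M\<close> by (simp only:)
    next
      case False
      then show ?thesis
        by (intro cfun.subspace_scale M mono) simp
    qed
  qed
  then have "M = {f \<in> hardy_space. \<forall>j<k. taylor_coeff f j = 0}"
    using M low by blast
  then show ?thesis
    unfolding image_power_mult_hardy_space by blast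
qed

theorem theorem3p4:
  fixes M :: "(complex \<Rightarrow> complex) set"
  shows "(M \<subseteq> hardy_space \<and> cfun.subspace M \<and> closedin hardy_topology M \<and> M \<noteq> {0} \<and>
          (\<forall>t::real. 0 \<le> t \<and> t < 1 \<longrightarrow> weighted_comp t ` M \<subseteq> M))
         \<longleftrightarrow> (\<exists>k::nat. M = (\<lambda>f z. z ^ k * f z) ` hardy_space)"
proof
  assume "M \<subseteq> hardy_space \<and> cfun.subspace M \<and> closedin hardy_topology M \<and> M \<noteq> {0} \<and>
    (\<forall>t::real. 0 \<le> t \<and> t < 1 \<longrightarrow> weighted_comp t ` M \<subseteq> M)"
  then show "\<exists>k::nat. M = (\<lambda>f z. z ^ k * f z) ` hardy_space"
    by (intro invariant_subspace_eq_power_mult) auto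
next
  assume "\<exists>k::nat. M = (\<lambda>f z. z ^ k * f z) ` hardy_space"
  \<comment> \<open>In this form the subspace and closedness lemmas apply with index set
    \<open>{..<k}\<close>.\<close>
  then obtain k where M: "M = {f \<in> hardy_space. \<forall>j\<in>{..<k}. taylor_coeff f j = 0}"
    by (auto simp: image_power_mult_hardy_space)
  have "disc_monomial k \<in> M"
    by (simp add: M disc_monomial_in_hardy_space taylor_coeff_disc_monomial)
  moreover have "disc_monomial k \<noteq> 0"
    using taylor_coeff_disc_monomial[of k k] taylor_coeff_zero[of k] by auto
  \<comment> \<open>If the coefficients below \<open>k\<close> vanish, so do their partial
    sums.\<close>
  moreover have "weighted_comp t f \<in> M" if "0 \<le> t" "t < 1" "f \<in> M" for t f
    using that by (auto simp: M weighted_comp_in_hardy_space taylor_coeff_weighted_comp)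
  ultimately show "M \<subseteq> hardy_space \<and> cfun.subspace M \<and> closedin hardy_topology M \<and> M \<noteq> {0} \<and>
      (\<forall>t::real. 0 \<le> t \<and> t < 1 \<longrightarrow> weighted_comp t ` M \<subseteq> M)"
    using subspace_vanishing_taylor_coeffs[of "{..<k}"] closedin_vanishing_taylor_coeffs[of "{..<k}"]
    unfolding M[symmetric] using M by blast
qed

end
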